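(* Let $(\Omega,\mu)$ be a probability space and $C\ge 1$. For all $n\in\mathbb N$, $n\ge 1$, the simple Monte Carlo method $S_n^{\mathrm{simple}}$ satisfies $$ e\big(S_n^{\mathrm{simple}},\mathcal F_C(\Omega)\big)\ \le\ 2\,\min\left\{1,\ \sqrt{\frac{2C}{n}}\right\}. $$
   Context: $\mathcal F_C(\Omega)$ is the set of all pairs $(f,\rho)$ of measurable functions $f,\rho:\Omega\to\mathbb R$ with $\|f\|_\infty\le 1$ (i.e. $|f(x)|\le 1$ for all $x$), $\rho>0$, and $\rho(x)/\rho(y)\le C$ for all $x,y\in\Omega$. $S(f,\rho)=\dfrac{\int_\Omega f\rho\,d\mu}{\int_\Omega\rho\,d\mu}$. Simple Monte Carlo: let $X_1,\dots,X_n$ be independent random elements of $\Omega$, identically distributed according to $\mu$, and $$S_n^{\mathrm{simple}}(f,\rho)=\frac{\sum_{j=1}^n f(X_j)\rho(X_j)}{\sum_{j=1}^n\rho(X_j)}.$$ Error: $e(S_n,(f,\rho))=\big(\mathbf E|S(f,\rho)-S_n(f,\rho)|^2\big)^{1/2}$ and $e(S_n,\mathcal F_C(\Omega))=\sup_{(f,\rho)\in\mathcal F_C(\Omega)}e(S_n,(f,\rho))$. *)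

theory Defs
  imports "HOL-Probability.Probability"
begin

definition F_class :: "'a measure \<Rightarrow> real \<Rightarrow> (('a \<Rightarrow> real) \<times> ('a \<Rightarrow> real)) set" where
  "F_class M C = {(f, \<rho>).
     f \<in> borel_measurable M \<and> \<rho> \<in> borel_measurable M \<and>
     (\<forall>x\<in>space M. \<bar>f x\<bar> \<le> 1) \<and>
     (\<forall>x\<in>space M. 0 < \<rho> x) \<and>
     (\<forall>x\<in>space M. \<forall>y\<in>space M. \<rho> x / \<rho> y \<le> C)}"

definition weighted_mean :: "'a measure \<Rightarrow> ('a \<Rightarrow> real) \<times> ('a \<Rightarrow> real) \<Rightarrow> real" where
  "weighted_mean M = (\<lambda>(f, \<rho>). (\<integral>x. f x * \<rho> x \<partial>M) / (\<integral>x. \<rho> x \<partial>M))"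

text \<open>A randomized method maps an input \<open>(f, \<rho>)\<close> to a real random variable on an
  underlying probability space with sample points of type \<open>'w\<close>.\<close>

definition simple_mc ::
  "(nat \<Rightarrow> 'w \<Rightarrow> 'a) \<Rightarrow> nat \<Rightarrow> ('a \<Rightarrow> real) \<times> ('a \<Rightarrow> real) \<Rightarrow> 'w \<Rightarrow> real" where
  "simple_mc X n = (\<lambda>(f, \<rho>) \<omega>.
     (\<Sum>j=1..n. f (X j \<omega>) * \<rho> (X j \<omega>)) / (\<Sum>j=1..n. \<rho> (X j \<omega>)))"

definition ennreal_sqrt :: "ennreal \<Rightarrow> ennreal" where
  "ennreal_sqrt t = (if t = \<infinity> then \<infinity> else ennreal (sqrt (enn2real t)))"

text \<open>The mean square error is a nonnegative integral and the worst case error a supremum in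
  \<^typ>\<open>ennreal\<close>, so that neither a non-integrable error nor an unbounded
  set of errors can be mistaken for a finite real value.\<close>

definition rms_error ::
  "'w measure \<Rightarrow> ('i \<Rightarrow> real) \<Rightarrow> ('i \<Rightarrow> 'w \<Rightarrow> real) \<Rightarrow> 'i \<Rightarrow> ennreal" where
  "rms_error P S A p = ennreal_sqrt (\<integral>\<^sup>+\<omega>. ennreal (\<bar>S p - A p \<omega>\<bar>\<^sup>2) \<partial>P)"

definition worst_case_error ::
  "'w measure \<Rightarrow> ('i \<Rightarrow> real) \<Rightarrow> ('i \<Rightarrow> 'w \<Rightarrow> real) \<Rightarrow> 'i set \<Rightarrow> ennreal" where
  "worst_case_error P S A F = (SUP p\<in>F. rms_error P S A p)"

end

theory Submission
  imports Defs
begin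

text \<open>
  Write \<open>a = \<integral>f\<rho>\<close>, \<open>b = \<integral>\<rho>\<close> and let \<open>A\<close>, \<open>B\<close> be the corresponding sample means, so that
  the method returns \<open>A / B\<close> as an approximation of \<open>a / b\<close>. Both quotients are weighted means of
  values in \<open>[-1, 1]\<close>, hence the error never exceeds \<open>2\<close>; this is the first term of the minimum.

  For the second term the random denominator has to be removed. The identity
  \<open>A / B - a / b = (A - a) / b + (A / B) \<cdot> (b - B) / b\<close> together with \<open>\<bar>A / B\<bar> \<le> 1\<close> bounds the error
  by \<open>(\<bar>A - a\<bar> + \<bar>B - b\<bar>) / b\<close> (\<open>ratio_perturbation\<close>). Independence gives
  \<open>\<bbbE>(A - a)\<^sup>2 \<le> \<integral>(f\<rho>)\<^sup>2 / n\<close> and \<open>\<bbbE>(B - b)\<^sup>2 \<le> \<integral>\<rho>\<^sup>2 / n\<close> (\<open>sample_mean_mse_le\<close>), and averaging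
  \<open>\<rho> x \<le> C \<rho> y\<close> over \<open>y\<close> gives \<open>\<rho> \<le> C b\<close>, so that both integrals are at most
  \<open>\<integral>\<rho>\<^sup>2 \<le> C b \<integral>\<rho> = C b\<^sup>2\<close> (\<open>second_moment_density_le\<close>). With \<open>(u + v)\<^sup>2 \<le> 2u\<^sup>2 + 2v\<^sup>2\<close> the mean square
  error is at most \<open>4C / n\<close>, which is half of \<open>(2 \<surd>(2C / n))\<^sup>2\<close>.
\<close>

text \<open>Only the deterministic \<open>b\<close> remains in the denominator, so that the expectation of the bound
  can be computed; the price is the hypothesis \<open>\<bar>A\<bar> \<le> B\<close>.\<close>

lemma ratio_perturbation:
  fixes A B a b :: real
  assumes "0 < b" "0 < B" "\<bar>A\<bar> \<le> B"
  shows "\<bar>a / b - A / B\<bar> \<le> (\<bar>A - a\<bar> + \<bar>B - b\<bar>) / b"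
proof -
  have "a / b - A / B = ((a - A) + (A / B) * (B - b)) / b"
    using assms by (simp add: field_simps)
  moreover have "\<bar>(a - A) + (A / B) * (B - b)\<bar> \<le> \<bar>A - a\<bar> + \<bar>B - b\<bar>"
  proof -
    have "\<bar>A / B\<bar> \<le> 1"
      using assms by simp
    then have "\<bar>(A / B) * (B - b)\<bar> \<le> \<bar>B - b\<bar>"
      by (simp only: abs_mult mult_left_le_one_le abs_ge_zero)
    then show ?thesis by linarith
  qed
  ultimately show ?thesis
    using \<open>0 < b\<close> by (simp add: divide_right_mono)
qed

lemma weighted_mean_abs_le_1:
  assumes "\<And>x. x \<in> space M \<Longrightarrow> \<bar>f x\<bar> \<le> 1" "\<And>x. x \<in> space M \<Longrightarrow> 0 < \<rho> x"
  shows "\<bar>weighted_mean M (f, \<rho>)\<bar> \<le> 1"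
proof (cases "integrable M \<rho> \<and> integrable M (\<lambda>x. f x * \<rho> x)")
  case True
  have "\<bar>\<integral>x. f x * \<rho> x \<partial>M\<bar> \<le> (\<integral>x. \<bar>f x * \<rho> x\<bar> \<partial>M)"
    by (rule integral_abs_bound)
  also have "\<dots> \<le> (\<integral>x. \<rho> x \<partial>M)"
  proof (rule integral_mono)
    fix x assume "x \<in> space M"
    with assms[of x] show "\<bar>f x * \<rho> x\<bar> \<le> \<rho> x"
      by (simp add: abs_mult mult_left_le_one_le)
  qed (use True in auto)
  finally show ?thesis
    by (cases "(\<integral>x. \<rho> x \<partial>M) = 0") (auto simp: weighted_mean_def divide_simps)
next
  case False
  \<comment> \<open>A non-integrable function has integral \<open>0\<close>, and \<open>x / 0 = 0\<close>, so the quotient is \<open>0\<close>.\<close>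
  then show ?thesis
    by (auto simp: weighted_mean_def not_integrable_integral_eq)
qed

text \<open>Off-diagonal products have mean zero, so the second moment of a sum of independent centred
  variables is the sum of their second moments.\<close>

lemma (in prob_space) second_moment_sum_indep_centered:
  fixes Y :: "'i \<Rightarrow> 'a \<Rightarrow> real"
  assumes fin: "finite I"
    and indep: "indep_vars (\<lambda>_. borel) Y I"
    and sq: "\<And>i. i \<in> I \<Longrightarrow> integrable M (\<lambda>\<omega>. (Y i \<omega>)\<^sup>2)"
    and centered: "\<And>i. i \<in> I \<Longrightarrow> expectation (Y i) = 0"
  shows "integrable M (\<lambda>\<omega>. (\<Sum>i\<in>I. Y i \<omega>)\<^sup>2)" (is ?int)
    and "expectation (\<lambda>\<omega>. (\<Sum>i\<in>I. Y i \<omega>)\<^sup>2) = (\<Sum>i\<in>I. expectation (\<lambda>\<omega>. (Y i \<omega>)\<^sup>2))" (is ?eq)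
proof -
  have Y: "random_variable borel (Y i)" if "i \<in> I" for i
    using indep that by (auto simp: indep_vars_def2)
  have intY: "integrable M (Y i)" if "i \<in> I" for i
    using square_integrable_imp_integrable[OF Y[OF that] sq[OF that]] .
  have prods: "integrable M (\<lambda>\<omega>. Y i \<omega> * Y j \<omega>) \<and>
      expectation (\<lambda>\<omega>. Y i \<omega> * Y j \<omega>) = (if i = j then expectation (\<lambda>\<omega>. (Y i \<omega>)\<^sup>2) else 0)"
    if "i \<in> I" "j \<in> I" for i j
  proof (cases "i = j")
    case True
    then show ?thesis
      using sq[OF \<open>i \<in> I\<close>] by (simp add: power2_eq_square)
  next
    case False
    have ind: "indep_vars (\<lambda>_. borel) Y {i, j}"
      using indep_vars_subset[OF indep] that by simp
    have int: "integrable M (Y k)" if "k \<in> {i, j}" for k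
      using intY that \<open>i \<in> I\<close> \<open>j \<in> I\<close> by auto
    show ?thesis
      using indep_vars_integrable[OF _ ind int] indep_vars_lebesgue_integral[OF _ ind int]
        centered \<open>i \<in> I\<close> False by simp
  qed
  have expand: "(\<Sum>i\<in>I. Y i \<omega>)\<^sup>2 = (\<Sum>i\<in>I. \<Sum>j\<in>I. Y i \<omega> * Y j \<omega>)" for \<omega>
    by (simp add: power2_eq_square sum_product)
  show ?int
    unfolding expand using prods by (intro Bochner_Integration.integrable_sum) auto
  have "expectation (\<lambda>\<omega>. (\<Sum>i\<in>I. Y i \<omega>)\<^sup>2) = (\<Sum>i\<in>I. \<Sum>j\<in>I. expectation (\<lambda>\<omega>. Y i \<omega> * Y j \<omega>))"
    unfolding expand using prods by (subst Bochner_Integration.integral_sum)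
      (auto intro!: sum.cong Bochner_Integration.integral_sum Bochner_Integration.integrable_sum)
  also have "\<dots> = (\<Sum>i\<in>I. \<Sum>j\<in>I. if i = j then expectation (\<lambda>\<omega>. (Y i \<omega>)\<^sup>2) else 0)"
    using prods by (intro sum.cong) auto
  also have "\<dots> = (\<Sum>i\<in>I. expectation (\<lambda>\<omega>. (Y i \<omega>)\<^sup>2))"
    using fin by simp
  finally show ?eq .
qed

text \<open>The mean square error of a sample mean is the variance of one sample divided by \<open>n\<close>; the
  variance is bounded by the second moment, which is easier to estimate.\<close>

lemma (in prob_space) sample_mean_mse_le:
  fixes X :: "nat \<Rightarrow> 'a \<Rightarrow> 'b" and g :: "'b \<Rightarrow> real"
  assumes N: "prob_space N"
    and n: "1 \<le> n"
    and indep: "indep_vars (\<lambda>_. N) X {1..n}"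
    and distr: "\<And>j. j \<in> {1..n} \<Longrightarrow> distr M N (X j) = N"
    and g[measurable]: "g \<in> borel_measurable N"
    and sq: "integrable N (\<lambda>x. (g x)\<^sup>2)"
  shows "integrable M (\<lambda>\<omega>. ((\<Sum>j=1..n. g (X j \<omega>)) / n - (\<integral>x. g x \<partial>N))\<^sup>2)" (is "integrable M ?err")
    and "expectation (\<lambda>\<omega>. ((\<Sum>j=1..n. g (X j \<omega>)) / n - (\<integral>x. g x \<partial>N))\<^sup>2)
           \<le> (\<integral>x. (g x)\<^sup>2 \<partial>N) / n" (is "_ \<le> ?bound")
proof -
  interpret N: prob_space N by (rule N)
  define m where "m = (\<integral>x. g x \<partial>N)"
  define Y where "Y j \<omega> = g (X j \<omega>) - m" for j \<omega>
  have intg: "integrable N g"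
    using N.square_integrable_imp_integrable[OF g sq] .
  have sqc: "integrable N (\<lambda>x. (g x - m)\<^sup>2)"
    using sq intg by (simp add: power2_diff)
  have X: "X j \<in> measurable M N" if "j \<in> {1..n}" for j
    using indep that by (auto simp: indep_vars_def2)
  have transfer_int: "integrable M (\<lambda>\<omega>. h (X j \<omega>)) \<longleftrightarrow> integrable N h"
    and transfer: "expectation (\<lambda>\<omega>. h (X j \<omega>)) = (\<integral>x. h x \<partial>N)"
    if "j \<in> {1..n}" "h \<in> borel_measurable N" for j and h :: "'b \<Rightarrow> real"
    using integrable_distr_eq[OF X[OF that(1)] that(2)] integral_distr[OF X[OF that(1)] that(2)]
    by (simp_all only: distr[OF that(1)])
  have indY: "indep_vars (\<lambda>_. borel) Y {1..n}"
    unfolding Y_def by (rule indep_vars_compose2[OF indep]) simp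
  have sqY: "integrable M (\<lambda>\<omega>. (Y j \<omega>)\<^sup>2)" if "j \<in> {1..n}" for j
    using transfer_int[OF that, of "\<lambda>x. (g x - m)\<^sup>2"] sqc by (simp add: Y_def)
  have meanY: "expectation (Y j) = 0" if "j \<in> {1..n}" for j
  proof -
    have "expectation (\<lambda>\<omega>. g (X j \<omega>) - m) = (\<integral>x. g x - m \<partial>N)"
      using transfer[OF that, of "\<lambda>x. g x - m"] by simp
    also have "\<dots> = 0"
      using intg by (simp add: m_def N.prob_space)
    finally show ?thesis by (simp add: Y_def[abs_def])
  qed
  have var: "expectation (\<lambda>\<omega>. (Y j \<omega>)\<^sup>2) \<le> (\<integral>x. (g x)\<^sup>2 \<partial>N)" if "j \<in> {1..n}" for j
  proof -
    have "expectation (\<lambda>\<omega>. (Y j \<omega>)\<^sup>2) = (\<integral>x. (g x - m)\<^sup>2 \<partial>N)"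
      using transfer[OF that, of "\<lambda>x. (g x - m)\<^sup>2"] by (simp add: Y_def)
    also have "\<dots> = (\<integral>x. (g x)\<^sup>2 \<partial>N) - m\<^sup>2"
      unfolding m_def by (rule N.variance_eq[OF intg sq])
    finally show ?thesis by simp
  qed
  note second = second_moment_sum_indep_centered[OF _ indY sqY meanY, simplified]
  have err: "?err = (\<lambda>\<omega>. (\<Sum>j=1..n. Y j \<omega>)\<^sup>2 / (real n)\<^sup>2)"
  proof
    fix \<omega>
    have "(\<Sum>j=1..n. g (X j \<omega>)) / n - m = (\<Sum>j=1..n. Y j \<omega>) / n"
      using n by (simp add: Y_def sum_subtractf field_simps)
    then show "?err \<omega> = (\<Sum>j=1..n. Y j \<omega>)\<^sup>2 / (real n)\<^sup>2"
      by (simp add: m_def power_divide)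
  qed
  show "integrable M ?err"
    unfolding err using second(1) by simp
  have "expectation ?err = (\<Sum>j=1..n. expectation (\<lambda>\<omega>. (Y j \<omega>)\<^sup>2)) / (real n)\<^sup>2"
    unfolding err using second(2) by simp
  also have "\<dots> \<le> (\<Sum>j=1..n. (\<integral>x. (g x)\<^sup>2 \<partial>N)) / (real n)\<^sup>2"
    using var by (intro divide_right_mono sum_mono) auto
  also have "\<dots> = ?bound"
    using n by (simp add: power2_eq_square)
  finally show "expectation ?err \<le> ?bound" .
qed

text \<open>A density of bounded ratio is bounded by \<open>C\<close> times its mean \<open>b\<close>. Estimating only one
  factor of \<open>\<rho>\<^sup>2\<close> by \<open>C b\<close> and integrating the other gives a bound linear in \<open>C\<close>, whereas the
  pointwise \<open>\<rho>\<^sup>2 \<le> C\<^sup>2 b\<^sup>2\<close> would give a quadratic one.\<close>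

lemma (in prob_space) second_moment_density_le:
  fixes \<rho> :: "'a \<Rightarrow> real"
  assumes [measurable]: "\<rho> \<in> borel_measurable M"
    and pos: "\<And>x. x \<in> space M \<Longrightarrow> 0 < \<rho> x"
    and ratio: "\<And>x y. x \<in> space M \<Longrightarrow> y \<in> space M \<Longrightarrow> \<rho> x / \<rho> y \<le> C"
  shows "integrable M \<rho>"
    and "0 < expectation \<rho>"
    and "integrable M (\<lambda>x. (\<rho> x)\<^sup>2)"
    and "expectation (\<lambda>x. (\<rho> x)\<^sup>2) \<le> C * (expectation \<rho>)\<^sup>2"
proof -
  obtain x0 where x0: "x0 \<in> space M"
    using not_empty by blast
  have le: "\<rho> x \<le> C * \<rho> y" if "x \<in> space M" "y \<in> space M" for x y
    using ratio[OF that] pos[OF that(2)] by (simp add: divide_simps)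
  show int: "integrable M \<rho>"
    using le[OF _ x0] pos
    by (intro integrable_const_bound[where B = "C * \<rho> x0"]) (auto intro!: AE_I2 simp: less_imp_le)
  show sq: "integrable M (\<lambda>x. (\<rho> x)\<^sup>2)"
    using le[OF _ x0] pos
    by (intro integrable_const_bound[where B = "(C * \<rho> x0)\<^sup>2"])
      (auto intro!: AE_I2 power_mono simp: less_imp_le)
  have le_mean: "\<rho> x \<le> C * expectation \<rho>" if "x \<in> space M" for x
    using integral_ge_const[of "\<lambda>y. C * \<rho> y" "\<rho> x"] int le[OF that] by (auto intro!: AE_I2)
  have nonneg: "0 \<le> expectation \<rho>"
    using pos by (intro integral_nonneg_AE AE_I2) (auto simp: less_imp_le)
  show "0 < expectation \<rho>"
    using nonneg le_mean[OF x0] pos[OF x0] by (cases "expectation \<rho> = 0") auto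
  have "expectation (\<lambda>x. (\<rho> x)\<^sup>2) \<le> expectation (\<lambda>x. (C * expectation \<rho>) * \<rho> x)"
    using sq int le_mean pos
    by (intro integral_mono) (auto simp: power2_eq_square less_imp_le mult_right_mono)
  then show "expectation (\<lambda>x. (\<rho> x)\<^sup>2) \<le> C * (expectation \<rho>)\<^sup>2"
    by (simp add: power2_eq_square mult.assoc)
qed

lemma ennreal_sqrt_le:
  assumes "t \<le> ennreal (r\<^sup>2)" "0 \<le> r"
  shows "ennreal_sqrt t \<le> ennreal r"
proof -
  have "t \<noteq> \<infinity>"
    using assms(1) by (auto simp: top_unique)
  moreover have "enn2real t \<le> r\<^sup>2"
    using enn2real_mono[OF assms(1)] by simp
  ultimately show ?thesis
    using assms(2) by (auto simp: ennreal_sqrt_def intro!: ennreal_leI real_le_lsqrt)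
qed

theorem theorem2:
  fixes M :: "'a measure" and P :: "'w measure"
    and X :: "nat \<Rightarrow> 'w \<Rightarrow> 'a" and C :: real and n :: nat
  assumes "prob_space M"
    and "C \<ge> 1"
    and "n \<ge> 1"
    and "prob_space P"
    and "prob_space.indep_vars P (\<lambda>_. M) X {1..n}"
    and "\<And>j. j \<in> {1..n} \<Longrightarrow> distr P M (X j) = M"
  shows "worst_case_error P (weighted_mean M) (simple_mc X n) (F_class M C)
           \<le> ennreal (2 * min 1 (sqrt (2 * C / real n)))"
  unfolding worst_case_error_def
proof (rule SUP_least)
  fix p assume p: "p \<in> F_class M C"
  obtain f \<rho> where p_eq: "p = (f, \<rho>)" by (cases p)
  from p have [measurable]: "f \<in> borel_measurable M" "\<rho> \<in> borel_measurable M"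
    and f: "\<And>x. x \<in> space M \<Longrightarrow> \<bar>f x\<bar> \<le> 1"
    and pos: "\<And>x. x \<in> space M \<Longrightarrow> 0 < \<rho> x"
    and ratio: "\<And>x y. x \<in> space M \<Longrightarrow> y \<in> space M \<Longrightarrow> \<rho> x / \<rho> y \<le> C"
    by (auto simp: p_eq F_class_def)
  interpret M: prob_space M by fact
  interpret P: prob_space P by fact
  note mc = P.sample_mean_mse_le[OF assms(1,3,5,6)]
  note \<rho> = M.second_moment_density_le[OF \<open>\<rho> \<in> borel_measurable M\<close> pos ratio]
  have X: "X j \<omega> \<in> space M" if "j \<in> {1..n}" "\<omega> \<in> space P" for j \<omega>
    using assms(5) that by (auto simp: P.indep_vars_def2 dest: measurable_space)

  have f\<rho>_sq_le: "(f x * \<rho> x)\<^sup>2 \<le> (\<rho> x)\<^sup>2" if "x \<in> space M" for x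
  proof -
    have "(f x)\<^sup>2 \<le> 1" using f[OF that] by (simp add: abs_square_le_1)
    then show ?thesis by (simp add: power_mult_distrib mult_left_le_one_le)
  qed
  have f\<rho>_sq: "integrable M (\<lambda>x. (f x * \<rho> x)\<^sup>2)"
    using f\<rho>_sq_le by (intro Bochner_Integration.integrable_bound[OF \<rho>(3)] AE_I2) auto

  define a b where "a = (\<integral>x. f x * \<rho> x \<partial>M)" and "b = (\<integral>x. \<rho> x \<partial>M)"
  define A B where "A \<omega> = (\<Sum>j=1..n. f (X j \<omega>) * \<rho> (X j \<omega>)) / n"
    and "B \<omega> = (\<Sum>j=1..n. \<rho> (X j \<omega>)) / n" for \<omega>
  define err where "err \<omega> = \<bar>weighted_mean M p - simple_mc X n p \<omega>\<bar>" for \<omega>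
  have b: "0 < b" using \<rho>(2) by (simp add: b_def)
  have mc_eq: "simple_mc X n p \<omega> = A \<omega> / B \<omega>" for \<omega>
    using \<open>n \<ge> 1\<close> by (simp add: p_eq simple_mc_def A_def B_def)
  have mean_eq: "weighted_mean M p = a / b"
    by (simp add: p_eq weighted_mean_def a_def b_def)
  have B: "0 < B \<omega>" if "\<omega> \<in> space P" for \<omega>
    using \<open>n \<ge> 1\<close> X[OF _ that] pos by (auto simp: B_def intro!: divide_pos_pos sum_pos)
  have A: "\<bar>A \<omega>\<bar> \<le> B \<omega>" if "\<omega> \<in> space P" for \<omega>
  proof -
    have "\<bar>\<Sum>j=1..n. f (X j \<omega>) * \<rho> (X j \<omega>)\<bar> \<le> (\<Sum>j=1..n. \<rho> (X j \<omega>))"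
      using X[OF _ that] f pos
      by (intro order_trans[OF sum_abs] sum_mono)
        (auto simp: abs_mult less_imp_le intro!: mult_left_le_one_le)
    then show ?thesis
      by (simp add: A_def B_def divide_right_mono)
  qed

  have err_sq_le_4: "(err \<omega>)\<^sup>2 \<le> 4" if "\<omega> \<in> space P" for \<omega>
  proof -
    have "\<bar>weighted_mean M p\<bar> \<le> 1"
      unfolding p_eq by (rule weighted_mean_abs_le_1) (auto intro: f pos)
    moreover have "\<bar>simple_mc X n p \<omega>\<bar> \<le> 1"
      using A[OF that] B[OF that] by (simp add: mc_eq)
    ultimately have "err \<omega> \<le> 2" "0 \<le> err \<omega>" by (auto simp: err_def)
    then show ?thesis using power_mono[of "err \<omega>" 2 2] by simp
  qed
  have "(\<integral>\<^sup>+\<omega>. ennreal ((err \<omega>)\<^sup>2) \<partial>P) \<le> (\<integral>\<^sup>+\<omega>. ennreal 4 \<partial>P)"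
    using err_sq_le_4 by (intro nn_integral_mono ennreal_leI)
  then have bound_trivial: "(\<integral>\<^sup>+\<omega>. ennreal ((err \<omega>)\<^sup>2) \<partial>P) \<le> ennreal 4"
    by (simp add: P.emeasure_space_1)

  \<comment> \<open>An integrable majorant of the squared error, with deterministic denominator.\<close>
  define D where "D \<omega> = 2 / b\<^sup>2 * ((A \<omega> - a)\<^sup>2 + (B \<omega> - b)\<^sup>2)" for \<omega>
  have err_sq_le_D: "(err \<omega>)\<^sup>2 \<le> D \<omega>" if "\<omega> \<in> space P" for \<omega>
  proof -
    have "err \<omega> \<le> (\<bar>A \<omega> - a\<bar> + \<bar>B \<omega> - b\<bar>) / b"
      unfolding err_def mc_eq mean_eq by (rule ratio_perturbation) (use b A B that in auto)
    then have "(err \<omega>)\<^sup>2 \<le> ((\<bar>A \<omega> - a\<bar> + \<bar>B \<omega> - b\<bar>) / b)\<^sup>2"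
      by (intro power_mono) (auto simp: err_def)
    also have "\<dots> \<le> (2 * (A \<omega> - a)\<^sup>2 + 2 * (B \<omega> - b)\<^sup>2) / b\<^sup>2"
      using sum_squares_bound[of "\<bar>A \<omega> - a\<bar>" "\<bar>B \<omega> - b\<bar>"]
      by (simp add: power_divide power2_sum divide_right_mono)
    also have "\<dots> = D \<omega>" by (simp add: D_def field_simps)
    finally show ?thesis .
  qed
  have intA: "integrable P (\<lambda>\<omega>. (A \<omega> - a)\<^sup>2)"
    and EA: "P.expectation (\<lambda>\<omega>. (A \<omega> - a)\<^sup>2) \<le> (\<integral>x. (f x * \<rho> x)\<^sup>2 \<partial>M) / n"
    unfolding A_def a_def using mc[OF _ _ f\<rho>_sq] by simp_all
  have intB: "integrable P (\<lambda>\<omega>. (B \<omega> - b)\<^sup>2)"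
    and EB: "P.expectation (\<lambda>\<omega>. (B \<omega> - b)\<^sup>2) \<le> (\<integral>x. (\<rho> x)\<^sup>2 \<partial>M) / n"
    unfolding B_def b_def using mc[OF _ _ \<rho>(3)] by simp_all
  have intD: "integrable P D"
    unfolding D_def using intA intB by simp
  have "(\<integral>x. (f x * \<rho> x)\<^sup>2 \<partial>M) \<le> (\<integral>x. (\<rho> x)\<^sup>2 \<partial>M)"
    using f\<rho>_sq \<rho>(3) f\<rho>_sq_le by (rule integral_mono)
  with \<rho>(4) have "(\<integral>x. (f x * \<rho> x)\<^sup>2 \<partial>M) / n + (\<integral>x. (\<rho> x)\<^sup>2 \<partial>M) / n \<le> 2 * C * b\<^sup>2 / n"
    by (simp add: b_def add_divide_distrib[symmetric] divide_right_mono)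
  with EA EB have "2 / b\<^sup>2 * (P.expectation (\<lambda>\<omega>. (A \<omega> - a)\<^sup>2) + P.expectation (\<lambda>\<omega>. (B \<omega> - b)\<^sup>2))
      \<le> 2 / b\<^sup>2 * (2 * C * b\<^sup>2 / n)"
    by (intro mult_left_mono) auto
  also have "\<dots> = 4 * C / n"
    using b by simp
  finally have ED: "P.expectation D \<le> 4 * C / n"
    using intA intB by (simp add: D_def[abs_def])
  have "(\<integral>\<^sup>+\<omega>. ennreal ((err \<omega>)\<^sup>2) \<partial>P) \<le> (\<integral>\<^sup>+\<omega>. ennreal (D \<omega>) \<partial>P)"
    using err_sq_le_D by (intro nn_integral_mono ennreal_leI)
  also have "\<dots> = ennreal (P.expectation D)"
    by (intro nn_integral_eq_integral intD AE_I2) (simp add: D_def)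
  also have "\<dots> \<le> ennreal (8 * C / n)"
    using ED \<open>C \<ge> 1\<close> by (intro ennreal_leI order_trans[OF ED]) (simp add: divide_right_mono)
  finally have bound_mc: "(\<integral>\<^sup>+\<omega>. ennreal ((err \<omega>)\<^sup>2) \<partial>P) \<le> ennreal (8 * C / n)" .

  have "(2 * min 1 (sqrt (2 * C / n)))\<^sup>2 = 4 \<or> (2 * min 1 (sqrt (2 * C / n)))\<^sup>2 = 8 * C / n"
    using \<open>C \<ge> 1\<close> by (auto simp: min_def power_mult_distrib)
  with bound_trivial bound_mc
  have "(\<integral>\<^sup>+\<omega>. ennreal ((err \<omega>)\<^sup>2) \<partial>P) \<le> ennreal ((2 * min 1 (sqrt (2 * C / n)))\<^sup>2)"
    by metis
  then show "rms_error P (weighted_mean M) (simple_mc X n) p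
      \<le> ennreal (2 * min 1 (sqrt (2 * C / real n)))"
    unfolding rms_error_def err_def using \<open>C \<ge> 1\<close> by (intro ennreal_sqrt_le) auto
qed

end
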